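(* Let $a(n)$ be the arithmetic function with $a(1)=0$ and $a(n)=\lambda(n)$ for $n\ge2$, where $\lambda$ is the Liouville function. For each $n\ge2$ let $\xi(n)\in(1/2,1)$ be the number satisfying $n^{-1}-n^{-1/2}=-\frac12\log(n)\,n^{-\xi(n)}$, and for $x\ge1$ let $$L_x(\xi)=\frac12\sum_{n\le x}\frac{a(n)\log(n)}{n^{\xi(n)}}$$ (the $n=1$ term is zero). If there exists $r>0$ such that $L_x(\xi)\le 1-r$ for all sufficiently large $x$, then $\frac{\zeta(2s)}{\zeta(s)}$ is analytic in the half-plane $\mathrm{Re}(s)>1/2$.
   Context: $\zeta(s)$ is the Riemann zeta function. The Liouville function $\lambda(n)$ is the completely multiplicative function with $\lambda(1)=1$ and $\lambda(p)=-1$ for every prime $p$. The sequence $\xi$ is the one obtained from the mean value theorem applied to $n^{-\gamma}$ on $[1/2,1]$, so that $\sum_{n\le x}a(n)n^{-1/2}=\sum_{n\le x}a(n)n^{-1}+L_x(\xi)$ for all $x\ge1$. *)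

theory Defs
  imports "HOL-Complex_Analysis.Complex_Analysis" "HOL-Computational_Algebra.Computational_Algebra"
begin

text \<open>Riemann zeta function on its half-plane of absolute convergence Re s > 1.\<close>
definition riemann_zeta :: "complex \<Rightarrow> complex" where
  "riemann_zeta s = (\<Sum>n. 1 / (of_nat (Suc n)) powr s)"

definition liouville :: "nat \<Rightarrow> real" where
  "liouville n = (-1) ^ size (prime_factorization n)"

definition a_fun :: "nat \<Rightarrow> real" where
  "a_fun n = (if n = 1 then 0 else liouville n)"

text \<open>xi(n) in (1/2,1) with n^-1 - n^-1/2 = -(1/2) log n * n^-xi(n) (unique, for n >= 2).\<close>
definition xi :: "nat \<Rightarrow> real" where
  "xi n = (THE g. 1/2 < g \<and> g < 1 \<and>
      1 / real n - 1 / sqrt (real n) = - (1/2) * ln (real n) * real n powr (- g))"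

definition L_xi :: "real \<Rightarrow> real" where
  "L_xi x = (1/2) * (\<Sum>n\<in>{1..nat \<lfloor>x\<rfloor>}. a_fun n * ln (real n) / real n powr xi n)"

end

theory Submission
  imports Defs
begin

text \<open>
  The terms of \<open>L_xi\<close> are \<open>liouville n * (n powr (-1/2) - n powr (-1))\<close>, hence their Dirichlet series is
  \<open>\<Lambda>(s + 1/2) - \<Lambda>(s + 1)\<close> with \<open>\<Lambda>(s) = \<zeta>(2s) / \<zeta>(s)\<close>. The hypothesis bounds \<open>L_xi\<close> from above by a
  constant \<open>C\<close>, so the numbers \<open>b n = C - L_xi n\<close> are nonnegative. By partial summation
  the series of \<open>b n * n powr (- s - 1)\<close> equals \<open>(C - \<Lambda>(s + 1/2) + \<Lambda>(s + 1)) / s\<close> up to a function holomorphic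
  for \<open>0 < Re s\<close>. The right-hand side is regular at every real \<open>s > 0\<close>, since there
  \<open>\<Lambda>(s + 1/2) = (1 - 2 powr (1/2 - s)) * \<zeta>(2s + 1) / \<eta>(s + 1/2)\<close> and the alternating series \<open>\<eta>\<close> is positive on
  the positive reals. By Landau's theorem on Dirichlet series with nonnegative coefficients
  the series therefore converges for \<open>0 < Re s\<close>, which continues \<open>\<Lambda>\<close> to \<open>1/2 < Re s\<close>.
\<close>

subsection \<open>Dirichlet series and Landau's theorem\<close>

text \<open>Series are indexed from \<open>0\<close>, so the coefficient of \<open>(n + 1) powr (- s)\<close> carries the index \<open>n\<close>.\<close>
definition npow :: "nat \<Rightarrow> complex \<Rightarrow> complex" where
  "npow n s = of_nat (Suc n) powr (- s)"

definition dirichlet_series :: "(nat \<Rightarrow> real) \<Rightarrow> complex \<Rightarrow> complex" where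
  "dirichlet_series c s = (\<Sum>n. of_real (c n) * npow n s)"

lemma npow_eq_exp: "npow n s = exp (- s * of_real (ln (real (Suc n))))"
  using Ln_of_nat[of "Suc n"] by (simp add: npow_def powr_def del: of_nat_Suc)

lemma norm_npow: "norm (npow n s) = real (Suc n) powr (- Re s)"
  by (simp add: npow_eq_exp powr_def del: of_nat_Suc)

lemma npow_of_real: "npow n (of_real x) = of_real (real (Suc n) powr (- x))"
  by (simp add: npow_eq_exp powr_def exp_of_real[symmetric] del: of_nat_Suc)

lemma npow_add: "npow n (s + t) = npow n s * npow n t"
  by (simp add: npow_def powr_add[symmetric] del: of_nat_Suc)

lemma holomorphic_npow [holomorphic_intros]:
  "f holomorphic_on S \<Longrightarrow> (\<lambda>s. npow n (f s)) holomorphic_on S"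
  unfolding npow_eq_exp by (intro holomorphic_intros)

section \<open>Holomorphy of series on half-planes\<close>

lemma open_Re_gt: "open {s. x < Re s}"
  by (simp add: open_halfspace_Re_gt)

lemma convex_Re_gt: "convex {s. x < Re s}"
  by (simp add: convex_halfspace_Re_gt)

text \<open>Weierstrass M-test in local form: each point needs a majorant only near itself, which
  suits series that converge locally uniformly but not uniformly on a half-plane.\<close>

lemma holomorphic_suminf:
  fixes f :: "nat \<Rightarrow> complex \<Rightarrow> complex"
  assumes S: "open S" and hol: "\<And>n. f n holomorphic_on S"
    and bound: "\<And>z. z \<in> S \<Longrightarrow> \<exists>d>0. \<exists>M. summable M \<and> (\<forall>n. \<forall>w\<in>S \<inter> ball z d. norm (f n w) \<le> M n)"
  shows "(\<lambda>s. \<Sum>n. f n s) holomorphic_on S"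
proof (rule holomorphic_uniform_sequence[OF S, where f = "\<lambda>N s. \<Sum>n<N. f n s"])
  show "(\<lambda>s. \<Sum>n<N. f n s) holomorphic_on S" for N
    by (intro holomorphic_intros hol)
  fix z assume "z \<in> S"
  then obtain d M where d: "d > 0" and M: "summable M"
      "\<And>n w. w \<in> S \<inter> ball z d \<Longrightarrow> norm (f n w) \<le> M n"
    using bound by metis
  obtain e where e: "e > 0" "cball z e \<subseteq> S"
    using S \<open>z \<in> S\<close> open_contains_cball by blast
  \<comment> \<open>Halving \<open>d\<close> fits a closed ball into the open ball on which the
    majorant is valid.\<close>
  have sub: "cball z (min e (d/2)) \<subseteq> S \<inter> ball z d"
    using e d by auto
  have "uniform_limit (cball z (min e (d/2))) (\<lambda>N s. \<Sum>n<N. f n s) (\<lambda>s. \<Sum>n. f n s) sequentially"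
    by (rule Weierstrass_m_test) (use M sub in blast)+
  then show "\<exists>d>0. cball z d \<subseteq> S \<and>
      uniform_limit (cball z d) (\<lambda>N s. \<Sum>n<N. f n s) (\<lambda>s. \<Sum>n. f n s) sequentially"
    using e d sub by (intro exI[of _ "min e (d/2)"]) auto
qed

lemma summable_norm_dirichlet:
  assumes "summable (\<lambda>n. \<bar>c n\<bar> * real (Suc n) powr (- Re s))"
  shows "summable (\<lambda>n. norm (of_real (c n) * npow n s))"
  using assms by (simp add: norm_mult norm_npow)

text \<open>On a ball whose radius is half the distance to the boundary line, every term is
  dominated by its absolute value at the leftmost real part, where the series converges
  absolutely.\<close>

lemma dirichlet_series_holomorphic:
  assumes "\<And>\<sigma>. x < \<sigma> \<Longrightarrow> summable (\<lambda>n. \<bar>c n\<bar> * real (Suc n) powr (- \<sigma>))"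
  shows "dirichlet_series c holomorphic_on {s. x < Re s}"
proof -
  have "(\<lambda>s. \<Sum>n. of_real (c n) * npow n s) holomorphic_on {s. x < Re s}"
  proof (rule holomorphic_suminf[OF open_Re_gt])
    show "(\<lambda>s. of_real (c n) * npow n s) holomorphic_on {s. x < Re s}" for n
      by (intro holomorphic_intros)
    fix z assume z: "z \<in> {s. x < Re s}"
    define d where "d = (Re z - x) / 2"
    have d: "d > 0" "x < Re z - d" using z by (auto simp: d_def field_simps)
    have "norm (of_real (c n) * npow n w) \<le> \<bar>c n\<bar> * real (Suc n) powr (- (Re z - d))"
      if "w \<in> ball z d" for n w
    proof -
      have "Re z - d \<le> Re w"
        using that abs_Re_le_cmod[of "z - w"] by (auto simp: dist_norm)
      then show ?thesis
        unfolding norm_mult norm_npow by (intro mult_mono powr_mono) auto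
    qed
    then show "\<exists>d>0. \<exists>M. summable M \<and>
        (\<forall>n. \<forall>w\<in>{s. x < Re s} \<inter> ball z d. norm (of_real (c n) * npow n w) \<le> M n)"
      using d assms[of "Re z - d"]
      by (intro exI[of _ d] conjI exI[of _ "\<lambda>n. \<bar>c n\<bar> * real (Suc n) powr (- (Re z - d))"]) auto
  qed
  then show ?thesis
    by (simp add: dirichlet_series_def[abs_def])
qed

lemma summable_dirichlet_mono:
  assumes "summable (\<lambda>n. \<bar>c n\<bar> * real (Suc n) powr (- x))" "x \<le> y"
  shows "summable (\<lambda>n. \<bar>c n\<bar> * real (Suc n) powr (- y))"
  by (rule summable_comparison_test_ev[OF _ assms(1)])
    (use assms(2) in \<open>simp add: mult_left_mono powr_mono abs_mult del: of_nat_Suc\<close>)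

section \<open>Landau's theorem\<close>

text \<open>Uniqueness of power series. It identifies coefficients found on a small disc with the
  Taylor coefficients, whose series converges on any larger disc of holomorphy.\<close>

lemma powser_coeff_eq:
  fixes f :: "complex \<Rightarrow> complex"
  assumes "r > 0" and "\<And>t. norm t < r \<Longrightarrow> (\<lambda>k. p k * t ^ k) sums f t"
  shows "p k = (deriv ^^ k) f 0 / fact k"
proof -
  have "summable (\<lambda>k. p k * of_real (r/2) ^ k)"
    using assms(2)[of "of_real (r/2)"] \<open>r > 0\<close> sums_summable by fastforce
  then have "conv_radius p \<ge> norm (of_real (r/2) :: complex)"
    by (rule conv_radius_geI)
  moreover have "0 < ereal (norm (of_real (r/2) :: complex))"
    using \<open>r > 0\<close> by simp
  ultimately have "fps_conv_radius (Abs_fps p) > 0"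
    unfolding fps_conv_radius_def fps_nth_Abs_fps by (rule less_le_trans[rotated])
  moreover have "eventually (\<lambda>z. eval_fps (Abs_fps p) z = f z) (nhds 0)"
  proof -
    have "eventually (\<lambda>z::complex. z \<in> ball 0 r) (nhds 0)"
      using \<open>r > 0\<close> by (intro eventually_nhds_in_open) auto
    then show ?thesis
      by eventually_elim (use assms(2) in \<open>auto simp: eval_fps_def sums_iff\<close>)
  qed
  ultimately have "f has_fps_expansion Abs_fps p"
    by (simp add: has_fps_expansion_def)
  from fps_nth_fps_expansion[OF this, of k] show ?thesis by simp
qed

text \<open>Expand around \<open>x + 1\<close>: the Taylor series converges a little beyond \<open>x\<close>, and by
  nonnegativity it may be rearranged back into the Dirichlet series.\<close>
lemma landau:
  assumes b: "\<And>n. 0 \<le> b n"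
    and sm: "\<And>\<sigma>. x < \<sigma> \<Longrightarrow> summable (\<lambda>n. b n * real (Suc n) powr (- \<sigma>))"
    and "d > 0" and H: "H holomorphic_on ball (of_real x) d"
    and HD: "\<And>s. s \<in> ball (of_real x) d \<Longrightarrow> x < Re s \<Longrightarrow> H s = dirichlet_series b s"
  shows "\<exists>\<sigma><x. summable (\<lambda>n. b n * real (Suc n) powr (- \<sigma>))"
proof -
  define a where "a = x + 1"
  \<comment> \<open>\<open>K\<close> glues the series to its continuation; \<open>HD\<close> makes
    both agree on the overlap.\<close>
  define K where "K s = (if x < Re s then dirichlet_series b s else H s)" for s
  \<comment> \<open>Measuring \<open>t\<close> to the left of \<open>a\<close> turns each term into
    a multiple of \<open>exp (t * l n)\<close>, so the Taylor coefficients \<open>p k\<close> are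
    nonnegative.\<close>
  define f where "f t = K (of_real a - t)" for t
  \<comment> \<open>By Pythagoras, the part of the disc of radius \<open>R\<close> about
    \<open>a\<close> that lies outside \<open>x < Re s\<close> is contained in the ball of radius
    \<open>d\<close> about \<open>x\<close>.\<close>
  define R where "R = sqrt (1 + d^2)"
  define l where "l n = ln (real (Suc n))" for n
  define q where "q n = b n * real (Suc n) powr (- a)" for n
  define p where "p k = (\<Sum>n. q n * (l n ^ k / fact k))" for k
  have l: "l n \<ge> 0" and q: "q n \<ge> 0" for n
    by (auto simp: l_def q_def b)
  have R: "R > 1" using \<open>d > 0\<close> by (simp add: R_def)
  have q_exp: "q n * exp (u * l n) = b n * real (Suc n) powr (- (a - u))" for n u
    by (simp add: q_def l_def powr_def mult.assoc exp_add[symmetric] algebra_simps)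
  have "K holomorphic_on {s. x < Re s} \<union> ball (of_real x) d"
  proof (intro holomorphic_on_Un open_Re_gt open_ball)
    have "dirichlet_series b holomorphic_on {s. x < Re s}"
      by (rule dirichlet_series_holomorphic) (use sm b in auto)
    then show "K holomorphic_on {s. x < Re s}"
      by (rule holomorphic_transform) (auto simp: K_def)
    show "K holomorphic_on ball (of_real x) d"
      by (rule holomorphic_transform[OF H]) (auto simp: K_def HD)
  qed
  moreover have "of_real a - t \<in> {s. x < Re s} \<union> ball (of_real x) d" if "t \<in> ball 0 R" for t
  proof (cases "Re t < 1")
    case True
    then show ?thesis by (simp add: a_def)
  next
    case False
    have "(Re t)^2 + (Im t)^2 < 1 + d^2"
      using that by (simp add: R_def cmod_def)
    moreover have "(1 - Re t)^2 + 1 \<le> (Re t)^2"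
      using False by (simp add: power2_eq_square algebra_simps)
    ultimately have "(1 - Re t)^2 + (Im t)^2 < d^2" by linarith
    then have "sqrt ((1 - Re t)^2 + (Im t)^2) < d"
      using \<open>d > 0\<close> by (simp add: real_less_lsqrt)
    then have "norm (of_real a - t - of_real x) < d"
      by (simp add: cmod_def a_def)
    then show ?thesis
      by (simp add: dist_norm norm_minus_commute)
  qed
  ultimately have "(K \<circ> (\<lambda>t. of_real a - t)) holomorphic_on ball 0 R"
    by (intro holomorphic_on_compose_gen[where g = K] holomorphic_intros) blast+
  then have f: "f holomorphic_on ball 0 R"
    by (simp add: f_def[abs_def] o_def)
  have inner: "((\<lambda>k. of_real (q n * (l n ^ k / fact k)) * t ^ k) has_sum of_real (q n) * exp (t * of_real (l n))) UNIV"
    for n and t :: complex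
  proof -
    have *: "(\<lambda>k. (t * of_real (l n)) ^ k /\<^sub>R fact k) sums exp (t * of_real (l n))"
      by (rule exp_converges)
    have "summable (\<lambda>k. norm ((t * of_real (l n)) ^ k /\<^sub>R fact k))"
      using summable_norm_exp[of "t * of_real (l n)"] by simp
    from norm_summable_imp_has_sum[OF this *]
    have "((\<lambda>k. of_real (q n) * ((t * of_real (l n)) ^ k /\<^sub>R fact k)) has_sum of_real (q n) * exp (t * of_real (l n))) UNIV"
      by (rule has_sum_cmult_right)
    then show ?thesis
      by (simp add: scaleR_conv_of_real field_simps)
  qed
  have inner_real: "((\<lambda>k. q n * (l n ^ k / fact k) * u ^ k) has_sum q n * exp (u * l n)) UNIV" for n u
  proof -
    have "((\<lambda>k. of_real (q n * (l n ^ k / fact k) * u ^ k) :: complex) has_sum of_real (q n * exp (u * l n))) UNIV"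
      using inner[of n "of_real u"] by (simp add: exp_of_real[symmetric])
    then show ?thesis by (simp only: has_sum_of_real_iff)
  qed
  \<comment> \<open>Summing over \<open>k\<close> first gives the Dirichlet series at
    \<open>a - u > x\<close>, which converges; all terms are nonnegative, so the double series is
    summable.\<close>
  have abs_sum: "(\<lambda>(n,k). q n * (l n ^ k / fact k) * u ^ k) summable_on UNIV \<times> UNIV"
    if "0 \<le> u" "u < 1" for u
  proof (rule summable_on_SigmaI)
    show "((\<lambda>k. case (n, k) of (n, k) \<Rightarrow> q n * (l n ^ k / fact k) * u ^ k) has_sum q n * exp (u * l n)) UNIV" for n
      using inner_real by simp
    show "(\<lambda>n. q n * exp (u * l n)) summable_on UNIV"
      unfolding q_exp using sm[of "a - u"] that b
      by (subst summable_on_UNIV_nonneg_real_iff) (auto simp: a_def)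
  qed (use l q that in auto)
  \<comment> \<open>Any \<open>u\<close> strictly between 0 and 1 would do in place of
    \<open>1/2\<close>: for fixed \<open>k\<close> the power is a constant factor.\<close>
  have p_has: "((\<lambda>n. q n * (l n ^ k / fact k)) has_sum p k) UNIV" for k
  proof -
    have "(\<lambda>(k,n). q n * (l n ^ k / fact k) * (1/2) ^ k) summable_on UNIV \<times> UNIV"
      using abs_sum[of "1/2"] by (subst summable_on_swap) simp
    from summable_on_SigmaD1[OF this, of k]
    have "(\<lambda>n. q n * (l n ^ k / fact k) * (1/2) ^ k) summable_on UNIV" by simp
    then have "(\<lambda>n. q n * (l n ^ k / fact k)) summable_on UNIV"
      by (subst (asm) summable_on_cmult_left') auto
    then have "summable (\<lambda>n. q n * (l n ^ k / fact k))"
      by (rule summable_on_imp_summable)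
    then show ?thesis
      unfolding p_def by (intro sums_nonneg_imp_has_sum summable_sums) (use l q in auto)
  qed
  have p0: "p k \<ge> 0" for k
    by (rule has_sum_nonneg[OF p_has]) (use l q in auto)
  have pt: "(\<lambda>k. of_real (p k) * t ^ k) sums f t" if t: "norm t < 1" for t
  proof -
    let ?g = "\<lambda>(n,k). of_real (q n * (l n ^ k / fact k)) * t ^ k"
    have "(\<lambda>z. norm (?g z)) summable_on UNIV \<times> UNIV"
      using abs_sum[of "norm t"] t l q
      by (simp add: case_prod_unfold norm_mult norm_power norm_divide)
    then have "?g summable_on UNIV \<times> UNIV"
      by (rule abs_summable_summable)
    then obtain s where s: "(?g has_sum s) (UNIV \<times> UNIV)"
      by (auto simp: summable_on_def)
    have "((\<lambda>n. of_real (q n) * exp (t * of_real (l n))) has_sum s) UNIV"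
      by (rule has_sum_SigmaD[OF s]) (use inner in simp)
    then have "(\<lambda>n. of_real (q n) * exp (t * of_real (l n))) sums s"
      by (rule has_sum_imp_sums)
    moreover have "of_real (q n) * exp (t * of_real (l n)) = of_real (b n) * npow n (of_real a - t)" for n
      by (simp add: q_def l_def npow_eq_exp powr_def exp_of_real[symmetric] mult.assoc exp_add[symmetric]
          algebra_simps del: of_nat_Suc)
    ultimately have "s = dirichlet_series b (of_real a - t)"
      by (simp add: dirichlet_series_def sums_iff)
    also have "\<dots> = f t"
      using t abs_Re_le_cmod[of t] by (auto simp: f_def K_def a_def)
    finally have sf: "s = f t" .
    have "((\<lambda>(k,n). ?g (n,k)) has_sum s) (UNIV \<times> UNIV)"
      using s by (subst (asm) has_sum_swap) simp
    then have "((\<lambda>k. of_real (p k) * t ^ k) has_sum s) UNIV"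
    proof (rule has_sum_SigmaD)
      show "((\<lambda>n. case (k, n) of (k, n) \<Rightarrow> ?g (n, k)) has_sum of_real (p k) * t ^ k) UNIV" for k
        using has_sum_cmult_left[OF has_sum_of_real[OF p_has[of k]], where c = "t ^ k"] by simp
    qed
    then show ?thesis using sf has_sum_imp_sums by blast
  qed
  define u where "u = (1 + R) / 2"
  have u: "1 < u" "u < R" using R by (auto simp: u_def)
  \<comment> \<open>The expansion \<open>pt\<close> only reaches \<open>norm t < 1\<close>, but
    \<open>f\<close> is holomorphic on the larger disc, so the same coefficients give a convergent
    series at \<open>u > 1\<close>.\<close>
  have "summable (\<lambda>k. p k * u ^ k)"
  proof -
    have "(\<lambda>k. (deriv ^^ k) f 0 / fact k * (of_real u - 0) ^ k) sums f (of_real u)"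
      by (rule holomorphic_power_series[OF f]) (use u in auto)
    then have "(\<lambda>k. of_real (p k) * of_real u ^ k) sums f (of_real u)"
      using powser_coeff_eq[of 1 "\<lambda>k. of_real (p k)", OF _ pt] by simp
    then have "summable (\<lambda>k. of_real (p k * u ^ k) :: complex)"
      by (simp add: sums_iff)
    then show ?thesis by (simp only: summable_of_real_iff)
  qed
  then have "(\<lambda>k. p k * u ^ k) summable_on UNIV"
    using p0 u by (subst summable_on_UNIV_nonneg_real_iff) auto
  \<comment> \<open>Nonnegativity allows the interchange of summations at this \<open>u\<close>, and
    summing over \<open>k\<close> now yields the Dirichlet series at
    \<open>a - u < x\<close>.\<close>
  then have "(\<lambda>(k,n). q n * (l n ^ k / fact k) * u ^ k) summable_on UNIV \<times> UNIV"
    by (rule summable_on_SigmaI[rotated]) (use l q u has_sum_cmult_left[OF p_has] in auto)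
  then have "(\<lambda>(n,k). q n * (l n ^ k / fact k) * u ^ k) summable_on UNIV \<times> UNIV"
    by (subst summable_on_swap) simp
  then have "(\<lambda>n. infsum (\<lambda>k. case (n, k) of (n, k) \<Rightarrow> q n * (l n ^ k / fact k) * u ^ k) UNIV) summable_on UNIV"
    by (rule summable_on_SigmaD) (use inner_real in \<open>auto simp: summable_on_def\<close>)
  then have "(\<lambda>n. q n * exp (u * l n)) summable_on UNIV"
    using infsumI[OF inner_real] by simp
  then have "summable (\<lambda>n. q n * exp (u * l n))"
    by (rule summable_on_imp_summable)
  then show ?thesis
    unfolding q_exp using u by (intro exI[of _ "a - u"]) (auto simp: a_def)
qed

subsection \<open>The divisor sum of the Liouville function\<close>

lemma liouville_1 [simp]: "liouville (Suc 0) = 1"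
  by (simp add: liouville_def)

lemma abs_liouville [simp]: "\<bar>liouville n\<bar> = 1"
  by (simp add: liouville_def power_abs)

lemma liouville_mult:
  "m > 0 \<Longrightarrow> n > 0 \<Longrightarrow> liouville (m * n) = liouville m * liouville n"
  by (simp add: liouville_def prime_factorization_mult power_add)

lemma liouville_prime_power: "prime p \<Longrightarrow> liouville (p ^ k) = (-1) ^ k"
  by (simp add: liouville_def prime_factorization_prime_power)

lemma sum_neg_one_power: "(\<Sum>j\<le>k. (-1) ^ j :: real) = (if even k then 1 else 0)"
  by (induction k) auto

text \<open>A divisor splits uniquely into a power of \<open>p\<close> and a divisor of
  \<open>m\<close>; the exponent is recovered as the multiplicity of \<open>p\<close>.\<close>

lemma divisors_prime_power_mult:
  fixes p m :: nat
  assumes "prime p" "\<not> p dvd m" "m > 0"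
  shows "bij_betw (\<lambda>(j,d). p ^ j * d) ({..k} \<times> {d. d dvd m}) {d. d dvd p ^ k * m}"
  unfolding bij_betw_def
proof
  have p: "p > 0" using assms(1) prime_gt_0_nat by blast
  have mult: "multiplicity p (p ^ j * d) = j" if "d dvd m" for j d
  proof -
    have "\<not> p dvd d" using that assms(2) dvd_trans by blast
    then show ?thesis
      using assms(1) by (intro multiplicity_eqI) auto
  qed
  show "inj_on (\<lambda>(j,d). p ^ j * d) ({..k} \<times> {d. d dvd m})"
  proof (rule inj_onI, clarsimp)
    fix i d j e assume "d dvd m" "e dvd m" and eq: "p ^ i * d = p ^ j * e"
    then have "i = j" using mult by metis
    then show "i = j \<and> d = e" using eq p by simp
  qed
  show "(\<lambda>(j,d). p ^ j * d) ` ({..k} \<times> {d. d dvd m}) = {d. d dvd p ^ k * m}"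
  proof (intro equalityI subsetI)
    fix x assume "x \<in> {d. d dvd p ^ k * m}"
    then obtain y z where yz: "x = y * z" "y dvd p ^ k" "z dvd m"
      by (auto elim: dvd_productE)
    then obtain j where "j \<le> k" "y = p ^ j"
      using divides_primepow_nat assms(1) by blast
    then show "x \<in> (\<lambda>(j,d). p ^ j * d) ` ({..k} \<times> {d. d dvd m})"
      using yz by force
  qed (auto intro: mult_dvd_mono le_imp_power_dvd)
qed

text \<open>Induction that splits off a full prime power \<open>p ^ k\<close>: the divisor sum
  factors, and its alternating factor over the exponents is 1 or 0 according to the parity of
  \<open>k\<close>.\<close>

lemma sum_liouville_divisors:
  assumes "n > 0"
  shows "(\<Sum>d | d dvd n. liouville d) = (if is_nth_power 2 n then 1 else 0)"
  using assms
proof (induction n rule: less_induct)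
  case (less n)
  show ?case
  proof (cases "n = 1")
    case False
    then obtain p where p: "prime p" "p dvd n"
      using prime_factor_nat by blast
    define k where "k = multiplicity p n"
    have "n \<noteq> 0" "\<not> is_unit p" using less.prems p by auto
    then obtain m where m: "n = p ^ k * m" "\<not> p dvd m"
      unfolding k_def using multiplicity_decompose' by blast
    have "m > 0" using m less.prems by (cases m) auto
    have "k > 0"
      using m p(2) by (cases k) auto
    then have "p ^ k > 1"
      using p(1) prime_gt_1_nat one_less_power by blast
    then have "m < n" using m \<open>m > 0\<close> by simp
    have pos: "d > 0" if "d dvd m" for d
      using that \<open>m > 0\<close> by (intro Nat.gr0I) auto
    have "(\<Sum>d | d dvd n. liouville d)
        = (\<Sum>(j,d)\<in>{..k} \<times> {d. d dvd m}. liouville (p ^ j * d))"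
      unfolding m(1) using sum.reindex_bij_betw[OF divisors_prime_power_mult[OF p(1) m(2) \<open>m > 0\<close>], of liouville k]
      by (simp add: case_prod_unfold)
    also have "\<dots> = (\<Sum>(j,d)\<in>{..k} \<times> {d. d dvd m}. (-1) ^ j * liouville d)"
      using pos p(1) prime_gt_0_nat
      by (intro sum.cong) (auto simp: liouville_mult liouville_prime_power)
    also have "\<dots> = (\<Sum>j\<le>k. (-1) ^ j) * (\<Sum>d | d dvd m. liouville d)"
      by (simp add: sum_product sum.cartesian_product)
    also have "\<dots> = (if even k \<and> is_nth_power 2 m then 1 else 0)"
      using less.IH[OF \<open>m < n\<close> \<open>m > 0\<close>] by (simp add: sum_neg_one_power)
    also have "(even k \<and> is_nth_power 2 m) = is_nth_power 2 n"
    proof -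
      have "coprime (p ^ k) m"
        using p(1) m(2) by (simp add: prime_imp_coprime)
      then show ?thesis
        unfolding m(1) using p(1)
        by (simp add: is_nth_power_mult_coprime_nat_iff is_nth_power_prime_power_nat_iff)
    qed
    finally show ?thesis .
  qed simp
qed

subsection \<open>The zeta and eta functions and the Liouville series\<close>

lemma summable_zeta_real: "1 < \<sigma> \<Longrightarrow> summable (\<lambda>n. real (Suc n) powr (- \<sigma>))"
  using summable_real_powr_iff[of "- \<sigma>"] summable_Suc_iff[of "\<lambda>n. real n powr (- \<sigma>)"] by simp

lemma riemann_zeta_eq: "riemann_zeta = dirichlet_series (\<lambda>_. 1)"
  by (auto simp: riemann_zeta_def dirichlet_series_def npow_def powr_minus field_simps fun_eq_iff
      simp del: of_nat_Suc)

lemma riemann_zeta_holomorphic: "riemann_zeta holomorphic_on {s. 1 < Re s}"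
  unfolding riemann_zeta_eq by (rule dirichlet_series_holomorphic) (use summable_zeta_real in simp)

lemma riemann_zeta_holomorphic_compose [holomorphic_intros]:
  assumes "f holomorphic_on S" "\<And>s. s \<in> S \<Longrightarrow> 1 < Re (f s)"
  shows "(\<lambda>s. riemann_zeta (f s)) holomorphic_on S"
  using holomorphic_on_compose_gen[OF assms(1) riemann_zeta_holomorphic] assms(2)
  by (auto simp: o_def)

abbreviation liouville_series :: "complex \<Rightarrow> complex" where
  "liouville_series \<equiv> dirichlet_series (\<lambda>n. liouville (Suc n))"

lemma liouville_series_holomorphic: "liouville_series holomorphic_on {s. 1 < Re s}"
  by (rule dirichlet_series_holomorphic) (use summable_zeta_real in simp)

lemma liouville_series_sums:
  "1 < Re s \<Longrightarrow> (\<lambda>n. of_real (liouville (Suc n)) * npow n s) sums liouville_series s"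
  unfolding dirichlet_series_def
  by (intro summable_sums summable_norm_cancel[OF summable_norm_dirichlet])
    (use summable_zeta_real in simp)

section \<open>Multiplying absolutely convergent Dirichlet series\<close>

text \<open>Passes from indices starting at 0 to the positive integers themselves, where products
  and divisors can be handled by reindexing.\<close>

lemma dirichlet_has_sum:
  assumes "summable (\<lambda>n. \<bar>c (Suc n)\<bar> * real (Suc n) powr (- Re s))"
  shows "((\<lambda>n. of_real (c n) * of_nat n powr (- s)) has_sum dirichlet_series (\<lambda>n. c (Suc n)) s) {0<..}"
    and "(\<lambda>n. norm (of_real (c n) * of_nat n powr (- s))) summable_on {0<..}"
proof -
  let ?f = "\<lambda>n. of_real (c n) * of_nat n powr (- s) :: complex"
  have bij: "bij_betw Suc UNIV {0<..}"
    by (rule bij_betwI[of _ _ _ "\<lambda>n. n - 1"]) auto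
  have sm: "summable (\<lambda>n. norm (?f (Suc n)))"
    using summable_norm_dirichlet[OF assms] by (simp only: npow_def)
  have "((\<lambda>n. ?f (Suc n)) has_sum dirichlet_series (\<lambda>n. c (Suc n)) s) UNIV"
    unfolding dirichlet_series_def npow_def
    by (intro norm_summable_imp_has_sum sm summable_sums summable_norm_cancel[OF sm])
  then show "(?f has_sum dirichlet_series (\<lambda>n. c (Suc n)) s) {0<..}"
    using has_sum_reindex_bij_betw[OF bij, of ?f] by simp
  have "(\<lambda>n. norm (?f (Suc n))) summable_on UNIV"
    using sm by (subst summable_on_UNIV_nonneg_real_iff) auto
  then show "(\<lambda>n. norm (?f n)) summable_on {0<..}"
    using summable_on_reindex_bij_betw[OF bij, of "\<lambda>n. norm (?f n)"] by simp
qed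

lemma has_sum_times:
  fixes f :: "'a \<Rightarrow> complex" and g :: "'b \<Rightarrow> complex"
  assumes f: "(f has_sum x) A" "(\<lambda>a. norm (f a)) summable_on A"
    and g: "(g has_sum y) B" "(\<lambda>b. norm (g b)) summable_on B"
  shows "((\<lambda>(a,b). f a * g b) has_sum x * y) (A \<times> B)"
proof (rule has_sum_SigmaI)
  show "((\<lambda>b. case (a, b) of (a, b) \<Rightarrow> f a * g b) has_sum f a * y) B" for a
    using has_sum_cmult_right[OF g(1)] by simp
  show "((\<lambda>a. f a * y) has_sum x * y) A"
    by (rule has_sum_cmult_left[OF f(1)])
  obtain z where z: "((\<lambda>b. norm (g b)) has_sum z) B"
    using g(2) by (auto simp: summable_on_def)
  have "(\<lambda>(a,b). norm (f a) * norm (g b)) summable_on A \<times> B"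
  proof (rule summable_on_SigmaI)
    show "((\<lambda>b. case (a, b) of (a, b) \<Rightarrow> norm (f a) * norm (g b)) has_sum norm (f a) * z) B" for a
      using has_sum_cmult_right[OF z] by simp
    show "(\<lambda>a. norm (f a) * z) summable_on A"
      by (rule summable_on_cmult_left[OF f(2)])
  qed auto
  then show "(\<lambda>(a,b). f a * g b) summable_on A \<times> B"
    by - (rule abs_summable_summable, simp add: case_prod_unfold norm_mult)
qed

text \<open>The double sum over \<open>(d, k)\<close> is regrouped by \<open>n = d * k\<close>; the
  inner divisor sum keeps only the squares, and a sum over squares is the zeta series at
  \<open>2 * s\<close>.\<close>

lemma liouville_zeta:
  assumes s: "1 < Re s"
  shows "liouville_series s * riemann_zeta s = riemann_zeta (2 * s)"
proof -
  let ?P = "{0<..} :: nat set"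
  let ?e = "\<lambda>n::nat. of_nat n powr (- s) :: complex"
  let ?g = "\<lambda>(n,d). of_real (liouville d) * ?e n"
  let ?x = "liouville_series s * riemann_zeta s"
  have "((\<lambda>(d,k). (of_real (liouville d) * ?e d) * (of_real 1 * ?e k)) has_sum ?x) (?P \<times> ?P)"
    unfolding riemann_zeta_eq
    by (rule has_sum_times; rule dirichlet_has_sum; use summable_zeta_real[OF s] in simp)
  moreover have "(((\<lambda>(d,k). (of_real (liouville d) * ?e d) * (of_real 1 * ?e k)) has_sum ?x) (?P \<times> ?P))
     = ((?g has_sum ?x) (SIGMA n:?P. {d. d dvd n}))"
  proof (rule has_sum_reindex_bij_witness[where j = "\<lambda>(d,k). (d * k, d)" and i = "\<lambda>(n,d). (d, n div d)"])
    show "?g (case p of (d, k) \<Rightarrow> (d * k, d)) =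
        (case p of (d, k) \<Rightarrow> (of_real (liouville d) * ?e d) * (of_real 1 * ?e k))" for p
      by (auto simp: powr_times_real split: prod.splits)
  qed (auto simp: dvd_div_eq_0_iff elim!: dvdE intro!: Nat.gr0I)
  ultimately have *: "(?g has_sum ?x) (SIGMA n:?P. {d. d dvd n})" by simp
  have sum: "((\<lambda>n. of_real (if is_nth_power 2 n then 1 else 0) * ?e n) has_sum ?x) ?P"
  proof (rule has_sum_SigmaD[OF *])
    fix n :: nat assume "n \<in> ?P"
    then have "(\<Sum>d | d dvd n. ?g (n, d)) = of_real (if is_nth_power 2 n then 1 else 0) * ?e n"
      using sum_liouville_divisors[of n] by (simp add: sum_distrib_right[symmetric] flip: of_real_sum)
    then show "((\<lambda>d. ?g (n, d)) has_sum of_real (if is_nth_power 2 n then 1 else 0) * ?e n) {d. d dvd n}"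
      using \<open>n \<in> ?P\<close> has_sum_finite[of "{d. d dvd n}" "\<lambda>d. ?g (n, d)"] by simp
  qed
  have "(?e has_sum ?x) ((\<lambda>k. k\<^sup>2) ` ?P)"
    by (rule iffD1[OF has_sum_cong_neutral sum]) (auto simp: is_nth_power_def image_iff intro!: Nat.gr0I)
  moreover have "inj_on (\<lambda>k::nat. k\<^sup>2) ?P"
    by (auto intro!: inj_onI)
  ultimately have "((?e \<circ> (\<lambda>k. k\<^sup>2)) has_sum ?x) ?P"
    by (simp add: has_sum_reindex)
  moreover have "?e \<circ> (\<lambda>k. k\<^sup>2) = (\<lambda>k. of_real 1 * of_nat k powr (- (2 * s)))"
  proof
    fix k :: nat
    have "of_nat (k\<^sup>2) powr (- s) = (of_nat k powr (- s) * of_nat k powr (- s) :: complex)"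
      by (subst powr_times_real[symmetric]) (auto simp: power2_eq_square)
    also have "\<dots> = of_nat k powr (- (2 * s))"
      by (simp add: powr_add[symmetric])
    finally show "(?e \<circ> (\<lambda>k. k\<^sup>2)) k = of_real 1 * of_nat k powr (- (2 * s))" by simp
  qed
  ultimately have "((\<lambda>k. of_real 1 * of_nat k powr (- (2 * s))) has_sum ?x) ?P"
    by (simp only:)
  moreover have "((\<lambda>k. of_real 1 * of_nat k powr (- (2 * s))) has_sum riemann_zeta (2 * s)) ?P"
    unfolding riemann_zeta_eq
    by (rule dirichlet_has_sum) (use summable_zeta_real[of "2 * Re s"] s in simp)
  ultimately show ?thesis by (rule has_sum_unique)
qed

section \<open>Non-vanishing of zeta for \<open>1 < Re s\<close>\<close>

text \<open>The terms after the leading 1 have total size at most \<open>pi\<^sup>2 / 6 - 1\<close>,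
  which is below 1.\<close>

lemma riemann_zeta_nonzero_of_gt_2:
  assumes s: "2 < Re s"
  shows "riemann_zeta s \<noteq> 0"
proof -
  have sq: "(\<lambda>n. 1 / real (Suc n) ^ 2) sums (pi\<^sup>2 / 6)"
    using inverse_squares_sums by (simp add: add.commute)
  then have sq': "(\<lambda>n. 1 / real (Suc (Suc n)) ^ 2) sums (pi\<^sup>2 / 6 - 1)"
    by (subst sums_Suc_iff) simp
  have le: "norm (npow n s) \<le> 1 / real (Suc n) ^ 2" for n
  proof -
    have "norm (npow n s) \<le> real (Suc n) powr (- 2)"
      unfolding norm_npow using s by (intro powr_mono) auto
    then show ?thesis
      by (simp add: powr_minus powr_numeral inverse_eq_divide)
  qed
  have sm: "summable (\<lambda>n. norm (npow n s))"
    using summable_zeta_real[of "Re s"] s by (simp add: norm_npow)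
  have "riemann_zeta s = (\<Sum>n. npow n s)"
    by (simp add: riemann_zeta_eq dirichlet_series_def)
  also have "\<dots> = npow 0 s + (\<Sum>n. npow (Suc n) s)"
    using suminf_split_head[OF summable_norm_cancel[OF sm]] by simp
  finally have eq: "riemann_zeta s = 1 + (\<Sum>n. npow (Suc n) s)"
    by (simp add: npow_def)
  have sm': "summable (\<lambda>n. norm (npow (Suc n) s))"
    using sm by (subst summable_Suc_iff)
  have "norm (\<Sum>n. npow (Suc n) s) \<le> (\<Sum>n. norm (npow (Suc n) s))"
    by (rule summable_norm[OF sm'])
  also have "\<dots> \<le> pi\<^sup>2 / 6 - 1"
    using suminf_le[OF le sm' sums_summable[OF sq']] sq' by (simp add: sums_iff)
  also have "\<dots> < 1"
  proof -
    have "pi\<^sup>2 \<le> 3.2\<^sup>2" using pi_approx by (intro power_mono) auto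
    then show ?thesis by (simp add: power2_eq_square)
  qed
  finally show ?thesis
    unfolding eq by (metis add_eq_0_iff norm_minus_cancel norm_one less_irrefl)
qed

text \<open>A zero at \<open>s\<close> would force one at \<open>2 * s\<close> through the product
  identity, where the real part exceeds 2. No Euler product is involved.\<close>

lemma riemann_zeta_nonzero:
  assumes s: "1 < Re s"
  shows "riemann_zeta s \<noteq> 0"
  using liouville_zeta[OF s] riemann_zeta_nonzero_of_gt_2[of "2 * s"] s by auto

section \<open>Mean value estimates for differences of powers\<close>

text \<open>Mean value inequality on the segment; as \<open>- Re s - 1\<close> is not positive, the
  derivative is largest in norm at the left end \<open>a\<close>.\<close>

lemma powr_diff_bound:
  assumes a: "0 < a" "a \<le> x" and s: "-1 \<le> Re s"
  shows "norm (of_real x powr (- s) - of_real a powr (- s) :: complex)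
    \<le> norm s * a powr (- Re s - 1) * (x - a)"
proof -
  have seg: "\<exists>y. z = of_real y \<and> a \<le> y" if "z \<in> closed_segment (of_real a) (of_real x :: complex)" for z
    using that a by (auto simp: closed_segment_of_real closed_segment_eq_real_ivl)
  have "norm (of_real x powr (- s) - of_real a powr (- s) :: complex)
      \<le> norm s * a powr (- Re s - 1) * norm (of_real x - of_real a :: complex)"
  proof (rule field_differentiable_bound[OF convex_closed_segment])
    fix z assume z: "z \<in> closed_segment (of_real a) (of_real x :: complex)"
    then obtain y where y: "z = of_real y" "a \<le> y" using seg by blast
    then show "((\<lambda>z. z powr (- s)) has_field_derivative (- s * z powr (- s - 1)))
        (at z within closed_segment (of_real a) (of_real x))"
      using a by (intro has_field_derivative_at_within[OF has_field_derivative_powr]) auto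
    have "norm (z powr (- s - 1)) = y powr (- Re s - 1)"
      using y a by (simp add: norm_powr_real_powr)
    also have "\<dots> \<le> a powr (- Re s - 1)"
      using y a s by (intro powr_mono2') auto
    finally show "norm (- s * z powr (- s - 1)) \<le> norm s * a powr (- Re s - 1)"
      by (simp add: norm_mult mult_left_mono)
  qed auto
  also have "norm (of_real x - of_real a :: complex) = x - a"
    using a by (simp flip: of_real_diff)
  finally show ?thesis .
qed

lemma npow_diff_bound:
  assumes "-1 \<le> Re s"
  shows "norm (npow n s - npow (Suc n) s) \<le> norm s * real (Suc n) powr (- Re s - 1)"
  using powr_diff_bound[of "real (Suc n)" "real (Suc (Suc n))" s] assms
  by (simp add: npow_def norm_minus_commute add.commute)

text \<open>Removing the linear term gains a further power of \<open>n\<close>: the derivative of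
  \<open>g\<close> is itself a difference of powers, so the first-order bound applies to it.\<close>

lemma npow_diff_bound2:
  assumes "-2 \<le> Re s"
  shows "norm (npow n s - npow (Suc n) s - s * npow n (s + 1))
    \<le> norm s * norm (s + 1) * real (Suc n) powr (- Re s - 2)"
proof -
  define a where "a = real (Suc n)"
  define x where "x = a + 1"
  have a: "0 < a" "a \<le> x" by (auto simp: a_def x_def)
  define g where "g z = - (z powr (- s)) - z * (s * of_real a powr (- s - 1))" for z :: complex
  have "norm (g (of_real x) - g (of_real a))
      \<le> (norm s * (norm (s + 1) * a powr (- Re s - 2))) * norm (of_real x - of_real a :: complex)"
  proof (rule field_differentiable_bound[OF convex_closed_segment])
    fix z assume z: "z \<in> closed_segment (of_real a) (of_real x :: complex)"
    then obtain y where y: "z = of_real y" "a \<le> y" "y \<le> x"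
      using a by (auto simp: closed_segment_of_real closed_segment_eq_real_ivl)
    show "(g has_field_derivative s * (z powr (- s - 1) - of_real a powr (- s - 1)))
        (at z within closed_segment (of_real a) (of_real x))"
      unfolding g_def using a y
      by (auto intro!: derivative_eq_intros has_field_derivative_at_within[OF has_field_derivative_powr]
          simp: algebra_simps)
    have e: "- (s + 1) = - s - 1" "- Re (s + 1) - 1 = - Re s - 2" by simp_all
    have "norm (of_real y powr (- (s + 1)) - of_real a powr (- (s + 1)) :: complex)
        \<le> norm (s + 1) * a powr (- Re (s + 1) - 1) * (y - a)"
      by (rule powr_diff_bound) (use a y assms in auto)
    also have "\<dots> \<le> norm (s + 1) * a powr (- Re (s + 1) - 1) * 1"
      by (intro mult_left_mono) (use y in \<open>auto simp: x_def\<close>)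
    finally have "norm (z powr (- s - 1) - of_real a powr (- s - 1)) \<le> norm (s + 1) * a powr (- Re s - 2)"
      unfolding y(1) mult_1_right by (simp only: e)
    then show "norm (s * (z powr (- s - 1) - of_real a powr (- s - 1)))
        \<le> norm s * (norm (s + 1) * a powr (- Re s - 2))"
      by (simp only: norm_mult mult_left_mono norm_ge_zero)
  qed auto
  moreover have "g (of_real x) - g (of_real a) = npow n s - npow (Suc n) s - s * npow n (s + 1)"
  proof -
    have "npow n (s + 1) = of_real a powr (- s - 1)"
      by (simp add: npow_def a_def)
    moreover have "npow n s = of_real a powr (- s)" "npow (Suc n) s = of_real x powr (- s)"
      by (simp_all add: npow_def a_def x_def add.commute)
    ultimately show ?thesis
      by (simp add: g_def x_def distrib_right)
  qed
  moreover have "norm (of_real x - of_real a :: complex) = 1"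
    by (simp add: x_def)
  ultimately show ?thesis
    by (simp only: a_def mult.assoc mult_1_right)
qed

section \<open>The alternating zeta function\<close>

text \<open>Consecutive terms of the alternating series are paired, which makes it absolutely convergent
  for \<open>0 < Re s\<close>.\<close>
definition dirichlet_eta :: "complex \<Rightarrow> complex" where
  "dirichlet_eta s = (\<Sum>k. npow (2 * k) s - npow (2 * k + 1) s)"

lemma dirichlet_eta_term_bound:
  assumes "0 < Re s"
  shows "norm (npow (2 * k) s - npow (2 * k + 1) s) \<le> norm s * real (Suc k) powr (- Re s - 1)"
proof -
  have "norm (npow (2 * k) s - npow (2 * k + 1) s) \<le> norm s * real (Suc (2 * k)) powr (- Re s - 1)"
    using npow_diff_bound[of s "2 * k"] assms by simp
  also have "\<dots> \<le> norm s * real (Suc k) powr (- Re s - 1)"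
    using assms by (intro mult_left_mono powr_mono2') auto
  finally show ?thesis .
qed

lemma dirichlet_eta_summable: "0 < Re s \<Longrightarrow> summable (\<lambda>k. npow (2 * k) s - npow (2 * k + 1) s)"
  by (rule summable_comparison_test'[where g = "\<lambda>k. norm s * real (Suc k) powr (- (Re s + 1))" and N = 0])
    (use dirichlet_eta_term_bound[of s] summable_zeta_real[of "Re s + 1"] in \<open>auto intro!: summable_mult\<close>)

text \<open>Supplies the uniform bounds on \<open>Re w\<close> and \<open>norm w\<close> from which
  majorants are built when a term bound depends on \<open>norm s\<close> as well.\<close>

lemma ball_bounds:
  assumes "z \<in> {s. x < Re s}"
  obtains d \<sigma> where "d > 0" "x < \<sigma>"
    "\<And>w. w \<in> ball z d \<Longrightarrow> \<sigma> \<le> Re w \<and> norm w \<le> norm z + d"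
proof (rule that[of "(Re z - x) / 2" "Re z - (Re z - x) / 2"])
  fix w assume w: "w \<in> ball z ((Re z - x) / 2)"
  then have "norm (z - w) < (Re z - x) / 2" by (simp add: dist_norm)
  moreover have "\<bar>Re z - Re w\<bar> \<le> norm (z - w)" "norm w - norm z \<le> norm (z - w)"
    using abs_Re_le_cmod[of "z - w"] norm_triangle_ineq2[of w z] by (auto simp: norm_minus_commute)
  ultimately show "Re z - (Re z - x) / 2 \<le> Re w \<and> norm w \<le> norm z + (Re z - x) / 2"
    by linarith
qed (use assms in \<open>auto simp: field_simps\<close>)

lemma dirichlet_eta_holomorphic: "dirichlet_eta holomorphic_on {s. 0 < Re s}"
  unfolding dirichlet_eta_def[abs_def]
proof (rule holomorphic_suminf[OF open_Re_gt])
  show "(\<lambda>s. npow (2 * k) s - npow (2 * k + 1) s) holomorphic_on {s. 0 < Re s}" for k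
    by (intro holomorphic_intros)
  fix z :: complex assume "z \<in> {s. 0 < Re s}"
  then obtain d \<sigma> where d: "d > 0" "0 < \<sigma>"
    and w: "\<And>w. w \<in> ball z d \<Longrightarrow> \<sigma> \<le> Re w \<and> norm w \<le> norm z + d"
    using ball_bounds by blast
  let ?M = "\<lambda>k. (norm z + d) * real (Suc k) powr (- (\<sigma> + 1))"
  have "summable ?M"
    using d by (intro summable_mult summable_zeta_real) simp
  moreover have "norm (npow (2 * k) w - npow (2 * k + 1) w) \<le> ?M k" if "w \<in> ball z d" for k w
  proof -
    have "norm (npow (2 * k) w - npow (2 * k + 1) w) \<le> norm w * real (Suc k) powr (- Re w - 1)"
      using w[OF that] d by (intro dirichlet_eta_term_bound) linarith
    also have "\<dots> \<le> ?M k"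
      using w[OF that] d by (intro mult_mono powr_mono) simp_all
    finally show ?thesis .
  qed
  ultimately show "\<exists>d>0. \<exists>M. summable M \<and>
      (\<forall>k. \<forall>w\<in>{s. 0 < Re s} \<inter> ball z d. norm (npow (2 * k) w - npow (2 * k + 1) w) \<le> M k)"
    using d(1) by blast
qed

text \<open>At a positive real point every paired term is strictly positive.\<close>

lemma dirichlet_eta_nonzero_of_real:
  assumes x: "0 < x"
  shows "dirichlet_eta (of_real x) \<noteq> 0"
proof -
  let ?t = "\<lambda>k. real (Suc (2 * k)) powr (- x) - real (Suc (2 * k + 1)) powr (- x)"
  have eq: "npow (2 * k) (of_real x) - npow (2 * k + 1) (of_real x) = of_real (?t k)" for k
    by (simp only: npow_of_real of_real_diff)
  have "summable (\<lambda>k. of_real (?t k) :: complex)"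
    using dirichlet_eta_summable[of "of_real x"] x unfolding eq by simp
  then have sm: "summable ?t" by (simp only: summable_of_real_iff)
  have "0 < suminf ?t"
    using sm by (rule suminf_pos) (use x in \<open>auto intro!: powr_less_mono2_neg\<close>)
  moreover have "dirichlet_eta (of_real x) = of_real (suminf ?t)"
    unfolding dirichlet_eta_def eq by (rule suminf_of_real[OF sm, symmetric])
  ultimately show ?thesis by simp
qed

text \<open>Odd indices stand for the even numbers \<open>2 * (k + 1)\<close>, whose terms are
  \<open>2 powr (- s) * npow k s\<close>; subtracting them twice from zeta produces the alternating
  signs.\<close>

lemma dirichlet_eta_zeta:
  assumes s: "1 < Re s"
  shows "dirichlet_eta s = (1 - 2 powr (1 - s)) * riemann_zeta s"
proof -
  have "summable (\<lambda>n. norm (npow n s))"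
    using summable_zeta_real[OF s] by (simp add: norm_npow)
  then have Z: "(\<lambda>n. npow n s) sums riemann_zeta s"
    by (simp add: riemann_zeta_eq dirichlet_series_def summable_norm_cancel summable_sums)
  have "(\<lambda>k. sum (\<lambda>n. npow n s) {k * 2..<k * 2 + 2}) sums riemann_zeta s"
    by (rule sums_group[OF Z]) simp
  moreover have "sum (\<lambda>n. npow n s) {k * 2..<k * 2 + 2} = npow (2 * k) s + npow (2 * k + 1) s" for k
    by (simp add: numeral_2_eq_2 mult.commute)
  moreover have "npow (2 * k + 1) s = 2 powr (- s) * npow k s" for k
  proof -
    have "(of_nat (Suc (2 * k + 1)) :: complex) = of_real 2 * of_real (real (Suc k))"
      by simp
    then show ?thesis
      unfolding npow_def by (simp only:) (subst powr_times_real, auto simp del: of_nat_Suc)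
  qed
  ultimately have "(\<lambda>k. npow (2 * k) s + 2 powr (- s) * npow k s) sums riemann_zeta s"
    by simp
  from sums_diff[OF this sums_mult[OF Z, of "2 * 2 powr (- s)"]]
  have "(\<lambda>k. npow (2 * k) s - 2 powr (- s) * npow k s) sums ((1 - 2 * 2 powr (- s)) * riemann_zeta s)"
    by (simp add: algebra_simps)
  moreover have "2 * 2 powr (- s) = 2 powr (1 - s)"
    by (simp add: powr_diff powr_minus field_simps)
  ultimately show ?thesis
    using \<open>\<And>k. npow (2 * k + 1) s = 2 powr (- s) * npow k s\<close>
    by (simp add: dirichlet_eta_def sums_iff)
qed

subsection \<open>The Dirichlet series of the partial sums of \<open>L_xi\<close>\<close>

text \<open>The \<open>THE\<close> in \<open>xi\<close> is justified by the mean value theorem for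
  existence and by injectivity of the exponential to a base above 1 for uniqueness.\<close>

lemma xi_spec:
  assumes "n \<ge> 2"
  shows "1 / real n - 1 / sqrt (real n) = - (1/2) * ln (real n) * real n powr (- xi n)"
proof -
  let ?P = "\<lambda>g. 1/2 < g \<and> g < 1 \<and>
      1 / real n - 1 / sqrt (real n) = - (1/2) * ln (real n) * real n powr (- g)"
  have n: "real n > 1" using assms by simp
  have "\<exists>g>1/2. g < 1 \<and> real n powr (- 1) - real n powr (- (1/2))
      = (1 - 1/2) * (- ln (real n) * real n powr (- g))"
    by (rule MVT2[of "1/2" 1 "\<lambda>g. real n powr (- g)"])
      (use n in \<open>auto intro!: derivative_eq_intros\<close>)
  then obtain g where g: "?P g"
    using n by (auto simp: powr_minus powr_half_sqrt inverse_eq_divide)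
  have "?P (xi n)"
    unfolding xi_def
  proof (rule theI[of ?P, OF g])
    fix h assume h: "?P h"
    have "ln (real n) > 0" using n by simp
    then have "real n powr (- h) = real n powr (- g)"
      using g h by simp
    then show "h = g" using n by (simp add: powr_inj)
  qed
  then show ?thesis by blast
qed

text \<open>The summand of \<open>L_xi\<close> at \<open>Suc n\<close> with \<open>xi\<close>
  eliminated. The exceptional value \<open>a_fun 1 = 0\<close> is absorbed, since the bracket
  vanishes at \<open>n = 0\<close>.\<close>

definition weight :: "nat \<Rightarrow> real" where
  "weight n = liouville (Suc n) * (real (Suc n) powr (- (1/2)) - real (Suc n) powr (- 1))"

lemma L_xi_eq_sum_weight: "L_xi (real (Suc n)) = (\<Sum>m\<le>n. weight m)"
proof -
  have "1/2 * (a_fun (Suc m) * ln (real (Suc m)) / real (Suc m) powr xi (Suc m)) = weight m" for m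
  proof (cases "m = 0")
    case False
    then have "1 / real (Suc m) - 1 / sqrt (real (Suc m))
        = - (1/2) * ln (real (Suc m)) * real (Suc m) powr (- xi (Suc m))"
      by (intro xi_spec) auto
    moreover have "real (Suc m) powr (- (1/2)) = 1 / sqrt (real (Suc m))"
        "real (Suc m) powr (- 1) = 1 / real (Suc m)"
      by (auto simp: powr_minus powr_half_sqrt inverse_eq_divide simp del: of_nat_Suc)
    ultimately have "real (Suc m) powr (- (1/2)) - real (Suc m) powr (- 1)
        = 1/2 * ln (real (Suc m)) * real (Suc m) powr (- xi (Suc m))"
      by linarith
    then show ?thesis
      using False by (simp add: weight_def a_fun_def powr_minus field_simps del: of_nat_Suc)
  qed (simp add: weight_def a_fun_def)
  moreover have "L_xi (real (Suc n))
      = (\<Sum>m\<le>n. 1/2 * (a_fun (Suc m) * ln (real (Suc m)) / real (Suc m) powr xi (Suc m)))"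
    unfolding L_xi_def sum_distrib_left floor_of_nat nat_int One_nat_def
      sum.atLeast_Suc_atMost_Suc_shift
    by (simp add: o_def atMost_atLeast0 del: of_nat_Suc)
  ultimately show ?thesis by simp
qed

lemma abs_weight_le: "\<bar>weight n\<bar> \<le> 1"
proof -
  have "real (Suc n) powr (- (1/2)) \<le> 1"
    using powr_mono[of "- (1/2)" 0 "real (Suc n)"] by simp
  moreover have "real (Suc n) powr (- 1) \<le> real (Suc n) powr (- (1/2))"
    by (rule powr_mono) simp_all
  moreover have "0 \<le> real (Suc n) powr (- 1)"
    by (rule powr_ge_zero)
  ultimately have "\<bar>real (Suc n) powr (- (1/2)) - real (Suc n) powr (- 1)\<bar> \<le> 1"
    by linarith
  then show ?thesis
    by (simp only: weight_def abs_mult abs_liouville mult_1)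
qed

lemma weight_sums:
  assumes "1/2 < Re s"
  shows "(\<lambda>n. of_real (weight n) * npow n s) sums (liouville_series (s + 1/2) - liouville_series (s + 1))"
proof -
  have "of_real (weight n) * npow n s = of_real (liouville (Suc n)) * npow n (s + 1/2)
      - of_real (liouville (Suc n)) * npow n (s + 1)" for n
    using npow_of_real[of n "1/2"] npow_of_real[of n 1]
    by (simp add: weight_def npow_add algebra_simps del: of_nat_Suc)
  then show ?thesis
    using sums_diff[OF liouville_series_sums[of "s + 1/2"] liouville_series_sums[of "s + 1"]] assms
    by simp
qed

section \<open>Partial summation for bounded coefficients\<close>

lemma sum_by_parts:
  fixes g :: "nat \<Rightarrow> complex" and c :: "nat \<Rightarrow> real"
  shows "(\<Sum>n<N. of_real (C - (\<Sum>m\<le>n. c m)) * (g n - g (Suc n)))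
    = of_real C * g 0 - (\<Sum>n<N. of_real (c n) * g n) - of_real (C - (\<Sum>n<N. c n)) * g N"
  by (induction N) (auto simp: lessThan_Suc_atMost[symmetric] algebra_simps)

text \<open>Subtracting from \<open>C\<close> makes a one-sided upper bound on the partial sums
  enough for nonnegativity.\<close>

definition deficit :: "(nat \<Rightarrow> real) \<Rightarrow> real \<Rightarrow> nat \<Rightarrow> real" where
  "deficit c C n = C - (\<Sum>m\<le>n. c m)"

text \<open>Only \<open>n powr (- s - 1)\<close> with nonnegative coefficients fits Landau's theorem, whereas partial summation
  produces the differences \<open>n powr (- s) - (n + 1) powr (- s)\<close>; the discrepancy is holomorphic
  already for \<open>0 < Re s\<close>.\<close>
definition remainder :: "(nat \<Rightarrow> real) \<Rightarrow> real \<Rightarrow> complex \<Rightarrow> complex" where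
  "remainder c C s = (\<Sum>n. of_real (deficit c C n) * (npow n s - npow (Suc n) s - s * npow n (s + 1)))"

context
  fixes c :: "nat \<Rightarrow> real" and C :: real
  assumes c: "\<And>n. \<bar>c n\<bar> \<le> 1"
begin

text \<open>A general index set serves both the deficits, with sums up to \<open>n\<close>, and the
  boundary term of partial summation, with sums below \<open>N\<close>.\<close>

lemma abs_diff_sum_le:
  assumes "card A \<le> Suc n"
  shows "\<bar>C - sum c A\<bar> \<le> (\<bar>C\<bar> + 1) * real (Suc n)"
proof -
  have "\<bar>sum c A\<bar> \<le> (\<Sum>m\<in>A. 1)"
    by (rule order.trans[OF sum_abs]) (intro sum_mono c)
  also have "\<dots> \<le> real (Suc n)"
    using assms by (simp only: real_of_card[symmetric] of_nat_le_iff)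
  finally have "\<bar>C - sum c A\<bar> \<le> \<bar>C\<bar> * 1 + real (Suc n)"
    by linarith
  also have "\<dots> \<le> \<bar>C\<bar> * real (Suc n) + real (Suc n)"
    by (intro add_right_mono mult_left_mono) auto
  finally show ?thesis by (simp add: distrib_right)
qed

lemma abs_deficit_le: "\<bar>deficit c C n\<bar> \<le> (\<bar>C\<bar> + 1) * real (Suc n)"
  unfolding deficit_def by (rule abs_diff_sum_le) simp

lemma Suc_mult_powr: "real (Suc n) * real (Suc n) powr x = real (Suc n) powr (x + 1)"
  by (simp add: powr_add del: of_nat_Suc)

text \<open>Deficits grow at most linearly, so the series converges beyond 2. This crude range is
  only the starting point for Landau's theorem.\<close>

lemma summable_deficit:
  assumes "2 < \<sigma>"
  shows "summable (\<lambda>n. \<bar>deficit c C n\<bar> * real (Suc n) powr (- \<sigma>))"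
proof (rule summable_comparison_test')
  show "summable (\<lambda>n. (\<bar>C\<bar> + 1) * real (Suc n) powr (- (\<sigma> - 1)))"
    using assms by (intro summable_mult summable_zeta_real) auto
  show "norm (\<bar>deficit c C n\<bar> * real (Suc n) powr (- \<sigma>)) \<le> (\<bar>C\<bar> + 1) * real (Suc n) powr (- (\<sigma> - 1))" for n
    using mult_right_mono[OF abs_deficit_le, of "real (Suc n) powr (- \<sigma>)" n]
    by (simp add: mult.assoc Suc_mult_powr add.commute del: of_nat_Suc)
qed

text \<open>Linear growth of the deficit costs one of the two powers gained by the second-order
  estimate; the exponent left over is summable for every positive \<sigma>.\<close>

lemma remainder_term_bound:
  assumes "\<sigma> \<le> Re s" "norm s \<le> B" "0 < \<sigma>"
  shows "norm (of_real (deficit c C n) * (npow n s - npow (Suc n) s - s * npow n (s + 1)))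
    \<le> (\<bar>C\<bar> + 1) * (B * (B + 1)) * real (Suc n) powr (- (\<sigma> + 1))"
proof -
  have B: "0 \<le> B" using assms(2) norm_ge_zero order.trans by blast
  have "norm (npow n s - npow (Suc n) s - s * npow n (s + 1))
      \<le> norm s * norm (s + 1) * real (Suc n) powr (- Re s - 2)"
    using assms by (intro npow_diff_bound2) auto
  also have "\<dots> \<le> B * (B + 1) * real (Suc n) powr (- \<sigma> - 2)"
    using assms B norm_triangle_ineq[of s 1] by (intro mult_mono powr_mono) auto
  finally have "norm (of_real (deficit c C n) * (npow n s - npow (Suc n) s - s * npow n (s + 1)))
      \<le> ((\<bar>C\<bar> + 1) * real (Suc n)) * (B * (B + 1) * real (Suc n) powr (- \<sigma> - 2))"
    unfolding norm_mult norm_of_real by (intro mult_mono abs_deficit_le) auto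
  also have "\<dots> = (\<bar>C\<bar> + 1) * (B * (B + 1)) * (real (Suc n) * real (Suc n) powr (- \<sigma> - 2))"
    by (simp only: mult_ac)
  also have "real (Suc n) * real (Suc n) powr (- \<sigma> - 2) = real (Suc n) powr (- (\<sigma> + 1))"
    unfolding Suc_mult_powr by (rule arg_cong[where f = "(powr) (real (Suc n))"]) simp
  finally show ?thesis .
qed

lemma remainder_summable:
  assumes "0 < Re s"
  shows "summable (\<lambda>n. of_real (deficit c C n) * (npow n s - npow (Suc n) s - s * npow n (s + 1)))"
proof (rule summable_comparison_test')
  show "summable (\<lambda>n. (\<bar>C\<bar> + 1) * (norm s * (norm s + 1)) * real (Suc n) powr (- (Re s + 1)))"
    using assms by (intro summable_mult summable_zeta_real) simp
qed (rule remainder_term_bound[OF order.refl order.refl assms])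

lemma remainder_holomorphic: "remainder c C holomorphic_on {s. 0 < Re s}"
  unfolding remainder_def[abs_def]
proof (rule holomorphic_suminf[OF open_Re_gt])
  show "(\<lambda>s. of_real (deficit c C n) * (npow n s - npow (Suc n) s - s * npow n (s + 1))) holomorphic_on {s. 0 < Re s}" for n
    by (intro holomorphic_intros)
  fix z :: complex assume "z \<in> {s. 0 < Re s}"
  then obtain d \<sigma> where d: "d > 0" "0 < \<sigma>"
    and w: "\<And>w. w \<in> ball z d \<Longrightarrow> \<sigma> \<le> Re w \<and> norm w \<le> norm z + d"
    using ball_bounds by blast
  let ?M = "\<lambda>n. (\<bar>C\<bar> + 1) * ((norm z + d) * (norm z + d + 1)) * real (Suc n) powr (- (\<sigma> + 1))"
  have "summable ?M"
    using d by (intro summable_mult summable_zeta_real) auto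
  moreover have "norm (of_real (deficit c C n) * (npow n w - npow (Suc n) w - w * npow n (w + 1))) \<le> ?M n"
    if "w \<in> ball z d" for n w
    using remainder_term_bound w[OF that] d(2) by blast
  ultimately show "\<exists>d>0. \<exists>M. summable M \<and> (\<forall>n. \<forall>w\<in>{s. 0 < Re s} \<inter> ball z d.
      norm (of_real (deficit c C n) * (npow n w - npow (Suc n) w - w * npow n (w + 1))) \<le> M n)"
    using d(1) by blast
qed

text \<open>The limit of summation by parts: \<open>remainder\<close> corrects the replacement of
  differences by \<open>s * npow n (s + 1)\<close>, and the boundary term is of order
  \<open>Suc N powr (1 - Re s)\<close>, hence tends to 0.\<close>

lemma deficit_series:
  assumes s: "1 < Re s" and l: "(\<lambda>n. of_real (c n) * npow n s) sums l"
  shows "s * dirichlet_series (deficit c C) (s + 1) + remainder c C s = of_real C - l"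
proof -
  have "(\<lambda>n. of_real (deficit c C n) * npow n (s + 1)) sums dirichlet_series (deficit c C) (s + 1)"
    unfolding dirichlet_series_def
    by (intro summable_sums summable_norm_cancel[OF summable_norm_dirichlet])
      (use summable_deficit[of "Re s + 1"] s in simp)
  from sums_add[OF sums_mult[OF this, of s] summable_sums[OF remainder_summable[of s]]] s
  have "(\<lambda>n. of_real (deficit c C n) * (npow n s - npow (Suc n) s))
      sums (s * dirichlet_series (deficit c C) (s + 1) + remainder c C s)"
    by (simp add: remainder_def algebra_simps)
  moreover have "(\<lambda>n. of_real (deficit c C n) * (npow n s - npow (Suc n) s)) sums (of_real C * npow 0 s - l - 0)"
    unfolding sums_def deficit_def sum_by_parts[where g = "\<lambda>n. npow n s"]
  proof (intro tendsto_diff tendsto_const l[unfolded sums_def])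
    have "(\<lambda>N. (\<bar>C\<bar> + 1) * real (Suc N) powr (1 - Re s)) \<longlonglongrightarrow> (\<bar>C\<bar> + 1) * 0"
      using s by (intro tendsto_mult tendsto_const tendsto_neg_powr
          filterlim_compose[OF filterlim_real_sequentially filterlim_Suc]) auto
    moreover have "norm (of_real (C - (\<Sum>n<N. c n)) * npow N s) \<le> (\<bar>C\<bar> + 1) * real (Suc N) powr (1 - Re s)" for N
      using mult_right_mono[OF abs_diff_sum_le[of "{..<N}" N], of "real (Suc N) powr (- Re s)"]
      by (simp add: norm_mult norm_npow mult.assoc Suc_mult_powr del: of_nat_Suc of_real_diff of_real_sum)
    ultimately show "(\<lambda>N. of_real (C - (\<Sum>n<N. c n)) * npow N s) \<longlonglongrightarrow> 0"
      unfolding mult_zero_right by (rule Lim_null_comparison[OF always_eventually[OF allI], rotated])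
  qed
  ultimately show ?thesis
    using sums_unique2 by (fastforce simp: npow_def)
qed

end

section \<open>Continuation to \<open>1/2 < Re s\<close>\<close>

text \<open>The finitely many partial sums before the bound takes effect are controlled by the sum
  of their absolute weights.\<close>

lemma L_xi_bounded_above:
  assumes "eventually (\<lambda>x. L_xi x \<le> B) at_top"
  obtains C where "\<And>n. (\<Sum>m\<le>n. weight m) \<le> C"
proof -
  obtain X where X: "\<And>x. x \<ge> X \<Longrightarrow> L_xi x \<le> B"
    using assms by (auto simp: eventually_at_top_linorder)
  obtain N where N: "real N \<ge> X" using real_arch_simple by blast
  have "(\<Sum>m\<le>n. weight m) \<le> \<bar>B\<bar> + (\<Sum>m\<le>N. \<bar>weight m\<bar>)" for n
  proof (cases "n \<le> N")
    case True
    have "(\<Sum>m\<le>n. weight m) \<le> (\<Sum>m\<le>n. \<bar>weight m\<bar>)"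
      by (intro sum_mono) simp
    also have "\<dots> \<le> (\<Sum>m\<le>N. \<bar>weight m\<bar>)"
      using True by (intro sum_mono2) auto
    finally show ?thesis by simp
  next
    case False
    then have "L_xi (real (Suc n)) \<le> B" using N by (intro X) simp
    moreover have "0 \<le> (\<Sum>m\<le>N. \<bar>weight m\<bar>)" by (rule sum_nonneg) simp
    ultimately show ?thesis unfolding L_xi_eq_sum_weight by linarith
  qed
  then show ?thesis using that by blast
qed

lemma holomorphic_shift:
  assumes "f holomorphic_on {s. y < Re s}" "y \<le> x + Re c"
  shows "(\<lambda>s. f (s + c)) holomorphic_on {s. x < Re s}"
proof -
  have "(f \<circ> (\<lambda>s. s + c)) holomorphic_on {s. x < Re s}"
    by (rule holomorphic_on_compose_gen[OF _ assms(1)])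
      (use assms(2) in \<open>auto intro!: holomorphic_intros\<close>)
  then show ?thesis by (simp add: o_def)
qed

theorem theorem3p3:
  assumes "\<exists>r>0. eventually (\<lambda>x. L_xi x \<le> 1 - r) at_top"
  shows "\<exists>f. f holomorphic_on {s. Re s > 1/2} \<and>
           (\<forall>s. Re s > 1 \<longrightarrow> f s = riemann_zeta (2 * s) / riemann_zeta s)"
proof -
  obtain C where C: "\<And>n. (\<Sum>m\<le>n. weight m) \<le> C"
    using assms L_xi_bounded_above by blast
  define b where "b = deficit weight C"
  define R where "R = remainder weight C"
  define P where "P \<sigma> \<longleftrightarrow> summable (\<lambda>n. b n * real (Suc n) powr (- \<sigma>))" for \<sigma>
  \<comment> \<open>\<open>F\<close> is \<open>deficit_series\<close> solved for
    \<open>liouville_series (s + 1/2)\<close>; for \<open>0 < Re s\<close> only the convergence of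
    the series of \<open>b\<close> at \<open>s + 1\<close> limits its range.\<close>
  define F where "F s = of_real C - s * dirichlet_series b (s + 1) - R s + liouville_series (s + 1)" for s
  \<comment> \<open>For \<open>1/2 < Re s\<close> this is
    \<open>dirichlet_eta (s + 1/2) * liouville_series (s + 1/2)\<close>, but the formula is
    holomorphic for \<open>0 < Re s\<close>.\<close>
  define G where "G s = (1 - 2 powr (1/2 - s)) * riemann_zeta (2 * s + 1)" for s
  have b: "b n \<ge> 0" for n
    using C by (simp add: b_def deficit_def)
  have R: "R holomorphic_on {s. 0 < Re s}"
    unfolding R_def by (rule remainder_holomorphic[where c = weight, OF abs_weight_le])
  have P_mono: "P y" if "P x" "x \<le> y" for x y
    using summable_dirichlet_mono[of b x y] that b by (simp add: P_def)
  have P3: "P 3"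
    using summable_deficit[where c = weight and C = C and \<sigma> = 3, OF abs_weight_le] b by (simp add: P_def b_def)
  have F_eq: "F s = liouville_series (s + 1/2)" if "1 < Re s" for s
    using deficit_series[where c = weight and C = C, OF abs_weight_le that weight_sums[of s]] that
    by (simp add: F_def b_def R_def algebra_simps)
  have hol: "F holomorphic_on {s. x - 1 < Re s}" and eta_F: "\<And>s. x - 1 < Re s \<Longrightarrow> dirichlet_eta (s + 1/2) * F s = G s"
    if x: "1 \<le> x" "\<And>\<sigma>. x < \<sigma> \<Longrightarrow> P \<sigma>" for x
  proof -
    let ?H = "{s. x - 1 < Re s}"
    have "dirichlet_series b holomorphic_on {s. x < Re s}"
      by (rule dirichlet_series_holomorphic) (use x(2) b in \<open>simp add: P_def\<close>)
    then have D: "(\<lambda>s. dirichlet_series b (s + 1)) holomorphic_on ?H"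
      by (rule holomorphic_shift) simp
    have R': "R holomorphic_on ?H"
      using R by (rule holomorphic_on_subset) (use x in auto)
    have L: "(\<lambda>s. liouville_series (s + 1)) holomorphic_on ?H"
      by (rule holomorphic_shift[OF liouville_series_holomorphic]) (use x in simp)
    show F: "F holomorphic_on ?H"
      unfolding F_def[abs_def] by (intro holomorphic_intros D R' L)
    have E: "(\<lambda>s. dirichlet_eta (s + 1/2)) holomorphic_on ?H"
      by (rule holomorphic_shift[OF dirichlet_eta_holomorphic]) (use x in simp)
    have G: "G holomorphic_on ?H"
      unfolding G_def[abs_def] using x by (intro holomorphic_intros) auto
    \<comment> \<open>The identity is clear for \<open>x < Re s\<close>, where \<open>F_eq\<close>
      applies, and the identity theorem extends it. The product form avoids dividing by possible
      zeros of \<open>dirichlet_eta\<close>.\<close>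
    show "dirichlet_eta (s + 1/2) * F s = G s" if s: "x - 1 < Re s" for s
    proof (rule analytic_continuation_open[where s = "{s. x < Re s}" and s' = ?H and f = "\<lambda>s. dirichlet_eta (s + 1/2) * F s"])
      have "of_real (x + 1) \<in> {s. x < Re s}" by simp
      then show "{s. x < Re s} \<noteq> {}" by blast
      show "dirichlet_eta (z + 1/2) * F z = G z" if "z \<in> {s. x < Re s}" for z
        using that x liouville_zeta[of "z + 1/2"]
        by (simp add: F_eq dirichlet_eta_zeta G_def algebra_simps)
    qed (use s in \<open>auto intro!: open_Re_gt convex_connected convex_Re_gt holomorphic_intros E F G\<close>)
  qed
  \<comment> \<open>Otherwise the abscissa of convergence \<open>S\<close> of \<open>b\<close> would be a singularity, but at \<open>S\<close> the series
    continues to \<open>H\<close>, because \<open>dirichlet_eta\<close> does not vanish at \<open>S - 1/2\<close>.\<close>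
  have P: "P x" if "1 < x" for x
  proof (rule ccontr)
    assume "\<not> P x"
    define S where "S = Inf (Collect P)"
    have low: "x \<le> y" if "P y" for y
      using P_mono[of y x] that \<open>\<not> P x\<close> by linarith
    then have bdd: "bdd_below (Collect P)"
      by (auto intro!: bdd_belowI)
    have S: "1 < S"
      unfolding S_def using P3 low by (intro less_le_trans[OF that] cInf_greatest) auto
    have PS: "P \<sigma>" if "S < \<sigma>" for \<sigma>
      using cInf_lessD[of "Collect P" \<sigma>] that P3 P_mono by (force simp: S_def)
    define U where "U = {z. 1 < Re z} \<inter> (\<lambda>z. dirichlet_eta (z - 1/2)) -` (- {0})"
    have E: "(\<lambda>z. dirichlet_eta (z - 1/2)) holomorphic_on {z. 1 < Re z}"
      using holomorphic_shift[OF dirichlet_eta_holomorphic, of 1 "-1/2"] by simp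
    have "open U"
      unfolding U_def
      by (intro continuous_open_preimage holomorphic_on_imp_continuous_on[OF E] open_Re_gt) auto
    moreover have "of_real S \<in> U"
      using S dirichlet_eta_nonzero_of_real[of "S - 1/2"] by (simp add: U_def)
    ultimately obtain d where d: "d > 0" "ball (of_real S) d \<subseteq> U"
      by (meson open_contains_ball)
    \<comment> \<open>The definition of \<open>F\<close> solved for the series of \<open>b\<close>
      at \<open>z = s + 1\<close>, with \<open>F\<close> replaced by
      \<open>G / dirichlet_eta\<close>; this is regular on \<open>U\<close>.\<close>
    define H where "H z = (of_real C - R (z - 1) + liouville_series z - G (z - 1) / dirichlet_eta (z - 1/2)) / (z - 1)" for z
    have U: "U \<subseteq> {z. 1 < Re z}" by (auto simp: U_def)
    have "\<exists>\<sigma><S. summable (\<lambda>n. b n * real (Suc n) powr (- \<sigma>))"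
    proof (rule landau[where H = H, OF b _ d(1)])
      show "summable (\<lambda>n. b n * real (Suc n) powr (- \<sigma>))" if "S < \<sigma>" for \<sigma>
        using PS[OF that] by (simp add: P_def)
      have "(\<lambda>z. R (z - 1)) holomorphic_on U"
        using holomorphic_on_subset[OF holomorphic_shift[OF R, of 1 "-1"] U] by simp
      moreover have "liouville_series holomorphic_on U"
        using liouville_series_holomorphic U holomorphic_on_subset by blast
      moreover have "(\<lambda>z. dirichlet_eta (z - 1/2)) holomorphic_on U"
        using E U holomorphic_on_subset by blast
      moreover have "(\<lambda>z. G (z - 1)) holomorphic_on U"
        unfolding G_def using U by (intro holomorphic_intros) auto
      ultimately have "H holomorphic_on U"
        unfolding H_def[abs_def] using U by (intro holomorphic_intros) (auto simp: U_def)
      then show "H holomorphic_on ball (of_real S) d"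
        using d(2) holomorphic_on_subset by blast
      fix z :: complex assume z: "z \<in> ball (of_real S) d" "S < Re z"
      then have "dirichlet_eta (z - 1/2) \<noteq> 0" "z \<noteq> 1" using d(2) S by (auto simp: U_def)
      moreover have "dirichlet_eta (z - 1/2) * F (z - 1) = G (z - 1)"
        using eta_F[of S "z - 1"] S PS z by simp
      ultimately show "H z = dirichlet_series b z"
        by (simp add: H_def F_def field_simps)
    qed
    \<comment> \<open>Convergence strictly to the left of the infimum \<open>S\<close> is the
      contradiction.\<close>
    then obtain \<sigma> where "\<sigma> < S" "P \<sigma>" by (auto simp: P_def)
    then show False
      using cInf_lower[of \<sigma> "Collect P"] bdd by (simp add: S_def)
  qed
  show ?thesis
  proof (intro exI[of _ "\<lambda>w. F (w - 1/2)"] conjI allI impI)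
    have "(F \<circ> (\<lambda>w. w - 1/2)) holomorphic_on {s. 1/2 < Re s}"
      by (rule holomorphic_on_compose_gen[OF _ hol[of 1]]) (use P in \<open>auto intro!: holomorphic_intros\<close>)
    then show "(\<lambda>w. F (w - 1/2)) holomorphic_on {s. 1/2 < Re s}"
      by (simp add: o_def)
    fix s :: complex assume s: "1 < Re s"
    have "norm (2 powr (1 - s)) < 1"
      using s powr_less_mono[of "1 - Re s" 0 2] by (simp add: norm_powr_real_powr)
    then have "1 - 2 powr (1 - s) \<noteq> 0" by auto
    \<comment> \<open>\<open>F_eq\<close> would require \<open>3/2 < Re s\<close> here, so the
      quotient is recovered from \<open>eta_F\<close> by cancelling the nonzero factor
      \<open>1 - 2 powr (1 - s)\<close>.\<close>
    moreover have "dirichlet_eta s * F (s - 1/2) = (1 - 2 powr (1 - s)) * riemann_zeta (2 * s)"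
      using eta_F[of 1 "s - 1/2"] P s by (simp add: G_def algebra_simps)
    ultimately have "riemann_zeta s * F (s - 1/2) = riemann_zeta (2 * s)"
      by (simp add: dirichlet_eta_zeta[OF s] mult.assoc)
    then show "F (s - 1/2) = riemann_zeta (2 * s) / riemann_zeta s"
      using riemann_zeta_nonzero[OF s] by (simp add: nonzero_eq_divide_eq mult.commute)
  qed
qed

end
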